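(* For all integers $n\ge 0$, $\mathrm{cp}_{0,0,1}(n)$ is the sum of the perimeters of the partitions of $n$.
   Context: A partition of a non-negative integer $n$ is a finite multiset of positive integers (its parts) with sum $n$; the empty multiset is the unique partition of $0$. The perimeter of a nonempty partition is the size of its largest part plus its number of parts minus one; equivalently, the perimeter is the number of cells in the union of the first row and first column of its Young diagram. In particular the empty partition has perimeter $0$. A $(0,0,1)$-copartition is a triple $(\gamma,\rho,\sigma)$ where $\gamma$ and $\sigma$ are nonempty finite multisets of non-negative integers (so parts equal to $0$ are allowed, with multiplicity, and count as parts), and $\rho$ is the multiset having the same number of parts as $\sigma$, each of which has size equal to the number of parts of $\gamma$ (zero parts are included in both counts). Its size is $|\gamma|+|\rho|+|\sigma|$, where $|\cdot|$ denotes the sum of parts. $\mathrm{cp}_{0,0,1}(n)$ is the number of $(0,0,1)$-copartitions of size $n$. *)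

theory Defs
  imports Main "HOL-Library.Multiset"
begin

definition partitions_of :: "nat \<Rightarrow> nat multiset set" where
  "partitions_of n = {p. 0 \<notin># p \<and> \<Sum>\<^sub># p = n}"

text \<open>Truncated subtraction is harmless here: a nonempty multiset has size at least 1.\<close>

definition perimeter :: "nat multiset \<Rightarrow> nat" where
  "perimeter p = (if p = {#} then 0 else Max (set_mset p) + size p - 1)"

text \<open>
  The components \<open>\<gamma>\<close> and \<open>\<sigma>\<close> may contain zero parts; \<^const>\<open>size\<close> counts them.
\<close>

definition is_copartition001 :: "nat multiset \<times> nat multiset \<times> nat multiset \<Rightarrow> bool" where
  "is_copartition001 = (\<lambda>(\<gamma>, \<rho>, \<sigma>).
     \<gamma> \<noteq> {#} \<and> \<sigma> \<noteq> {#} \<and> \<rho> = replicate_mset (size \<sigma>) (size \<gamma>))"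

definition copartition_size :: "nat multiset \<times> nat multiset \<times> nat multiset \<Rightarrow> nat" where
  "copartition_size = (\<lambda>(\<gamma>, \<rho>, \<sigma>). \<Sum>\<^sub># \<gamma> + \<Sum>\<^sub># \<rho> + \<Sum>\<^sub># \<sigma>)"

definition cp001 :: "nat \<Rightarrow> nat" where
  "cp001 n = card {c. is_copartition001 c \<and> copartition_size c = n}"

text \<open>Finiteness of the two sets involved, so that \<^const>\<open>card\<close> and \<^const>\<open>sum\<close> do not
  take their default value 0.\<close>

lemma finite_bounded_multisets: "finite {p :: nat multiset. size p \<le> n \<and> set_mset p \<subseteq> {..n}}"
proof (rule finite_subset)
  show "{p :: nat multiset. size p \<le> n \<and> set_mset p \<subseteq> {..n}}
      \<subseteq> mset ` {xs. set xs \<subseteq> {..n} \<and> length xs \<le> n}"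
  proof
    fix p :: "nat multiset"
    assume "p \<in> {p. size p \<le> n \<and> set_mset p \<subseteq> {..n}}"
    moreover obtain xs where "p = mset xs" by (metis ex_mset)
    ultimately show "p \<in> mset ` {xs. set xs \<subseteq> {..n} \<and> length xs \<le> n}" by auto
  qed
qed (simp add: finite_lists_length_le)

lemma size_le_sum_mset: "0 \<notin># p \<Longrightarrow> size p \<le> \<Sum>\<^sub># (p :: nat multiset)"
  by (induction p) auto

lemma part_le_sum_mset: "x \<in># p \<Longrightarrow> x \<le> \<Sum>\<^sub># (p :: nat multiset)"
  by (induction p) auto

lemma finite_partitions_of: "finite (partitions_of n)"
  by (rule finite_subset[OF _ finite_bounded_multisets[of n]])
     (auto simp: partitions_of_def size_le_sum_mset part_le_sum_mset)

lemma finite_copartitions001: "finite {c. is_copartition001 c \<and> copartition_size c = n}"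
proof -
  let ?B = "{p :: nat multiset. size p \<le> n \<and> set_mset p \<subseteq> {..n}}"
  have "{c. is_copartition001 c \<and> copartition_size c = n}
      \<subseteq> (\<lambda>(\<gamma>, \<sigma>). (\<gamma>, replicate_mset (size \<sigma>) (size \<gamma>), \<sigma>)) ` (?B \<times> ?B)"
  proof
    fix c assume c: "c \<in> {c. is_copartition001 c \<and> copartition_size c = n}"
    obtain \<gamma> \<rho> \<sigma> where [simp]: "c = (\<gamma>, \<rho>, \<sigma>)" by (cases c)
    have ne: "\<gamma> \<noteq> {#}" "\<sigma> \<noteq> {#}" and \<rho>: "\<rho> = replicate_mset (size \<sigma>) (size \<gamma>)"
      and n: "\<Sum>\<^sub># \<gamma> + size \<sigma> * size \<gamma> + \<Sum>\<^sub># \<sigma> = n"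
      using c by (auto simp: is_copartition001_def copartition_size_def)
    have "size \<gamma> \<le> size \<sigma> * size \<gamma>" "size \<sigma> \<le> size \<sigma> * size \<gamma>"
      using ne by (auto simp: Suc_le_eq nonempty_has_size)
    then have "size \<gamma> \<le> n" "size \<sigma> \<le> n" "\<Sum>\<^sub># \<gamma> \<le> n" "\<Sum>\<^sub># \<sigma> \<le> n" using n by linarith+
    then have "\<gamma> \<in> ?B" "\<sigma> \<in> ?B" by (auto dest: part_le_sum_mset)
    then show "c \<in> (\<lambda>(\<gamma>, \<sigma>). (\<gamma>, replicate_mset (size \<sigma>) (size \<gamma>), \<sigma>)) ` (?B \<times> ?B)"
      using \<rho> by (auto simp: image_iff)
  qed
  then show ?thesis
    by (rule finite_subset) (intro finite_imageI finite_cartesian_product finite_bounded_multisets)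
qed

end

theory Submission
  imports Defs
begin

text \<open>
  Write \<open>k\<close> and \<open>m\<close> for the numbers of parts of \<open>\<gamma>\<close> and \<open>\<sigma>\<close>. Put the Young diagram of \<open>\<gamma>\<close> to
  the right of a rectangle with \<open>k\<close> rows and \<open>m\<close> columns (this is the diagram of \<open>\<rho>\<close>, up to
  transposition), and the transpose of the diagram of \<open>\<sigma>\<close> below it. The result is the diagram
  of a partition \<open>p\<close> of \<open>n\<close> whose \<open>k\<close> largest parts are at least \<open>m\<close> and whose other parts are
  at most \<open>m\<close>; in other words, the corner \<open>(k, m)\<close> of the rectangle lies on the boundary path of
  \<open>p\<close>. Conversely, \<open>p\<close> together with such a point determines \<open>\<gamma>\<close> and \<open>\<sigma>\<close>. Hence
  \<open>cp001 n\<close> counts the pairs of a partition \<open>p\<close> of \<open>n\<close> and a lattice point \<open>(k, m)\<close> with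
  \<open>k, m \<ge> 1\<close> on its boundary path (lemma \<open>bij_betw_copartitions\<close>). The path of a nonempty \<open>p\<close> with
  largest part \<open>L\<close> and \<open>l\<close> parts has \<open>L + l + 1\<close> lattice points, of which only the two end points
  have a coordinate \<open>0\<close>, so that \<open>L + l - 1\<close> points remain, which is the perimeter (lemma
  \<open>card_boundary_points\<close>).

  Transposition enters only as a sum-preserving bijection between multisets with exactly \<open>m\<close> parts,
  zeros allowed, and partitions with parts at most \<open>m\<close>; lemma \<open>conjugation\<close> obtains it by
  recursion on \<open>m\<close>.
\<close>

section \<open>Conjugation\<close>

text \<open>Subtracting the least part from all others leaves an arbitrary multiset with one part less.\<close>

lemma bij_betw_split_Min:
  "bij_betw (\<lambda>(x, \<tau>). add_mset x (image_mset ((+) x) \<tau>))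
     (UNIV \<times> {\<tau>. size \<tau> = m}) {\<sigma> :: nat multiset. size \<sigma> = Suc m}"
proof -
  let ?g = "\<lambda>(x, \<tau>). add_mset x (image_mset ((+) x) \<tau>) :: nat multiset"
  let ?h = "\<lambda>\<sigma> :: nat multiset. (Min (set_mset \<sigma>),
              image_mset (\<lambda>y. y - Min (set_mset \<sigma>)) (\<sigma> - {#Min (set_mset \<sigma>)#}))"
  show ?thesis
  proof (rule bij_betw_byWitness[where f' = ?h])
    have "Min (insert x ((+) x ` set_mset \<tau>)) = x" for x :: nat and \<tau>
      by (rule Min_eqI) auto
    then show "\<forall>a \<in> UNIV \<times> {\<tau>. size \<tau> = m}. ?h (?g a) = a"
      by (auto simp: multiset.map_comp comp_def)
    show "\<forall>\<sigma> \<in> {\<sigma>. size \<sigma> = Suc m}. ?g (?h \<sigma>) = \<sigma>"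
    proof
      fix \<sigma> :: "nat multiset" assume "\<sigma> \<in> {\<sigma>. size \<sigma> = Suc m}"
      then have ne: "\<sigma> \<noteq> {#}" by auto
      let ?x = "Min (set_mset \<sigma>)"
      have x: "?x \<in># \<sigma>" using ne by simp
      have "image_mset ((+) ?x) (image_mset (\<lambda>y. y - ?x) (\<sigma> - {#?x#}))
              = image_mset (\<lambda>y. y) (\<sigma> - {#?x#})"
        unfolding multiset.map_comp comp_def
        by (rule image_mset_cong) (auto dest: in_diffD)
      then show "?g (?h \<sigma>) = \<sigma>" using x by simp
    qed
    show "?g ` (UNIV \<times> {\<tau>. size \<tau> = m}) \<subseteq> {\<sigma>. size \<sigma> = Suc m}" by auto
    show "?h ` {\<sigma>. size \<sigma> = Suc m} \<subseteq> UNIV \<times> {\<tau>. size \<tau> = m}"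
    proof clarsimp
      fix \<sigma> :: "nat multiset" assume s: "size \<sigma> = Suc m"
      then have "\<sigma> \<noteq> {#}" by auto
      then show "size (\<sigma> - {#Min (set_mset \<sigma>)#}) = m"
        using s by (simp add: size_Diff_singleton)
    qed
  qed
qed

text \<open>Here \<open>x\<close> is the number of parts equal to the largest admissible part \<open>Suc m\<close>.\<close>

lemma bij_betw_split_top_part:
  "bij_betw (\<lambda>(x, \<beta>). replicate_mset x (Suc m) + \<beta>)
     (UNIV \<times> {\<beta>. set_mset \<beta> \<subseteq> {1..m}}) {\<beta>. set_mset \<beta> \<subseteq> {1..Suc m}}"
proof (rule bij_betw_byWitness[where f' = "\<lambda>\<beta>. (count \<beta> (Suc m), filter_mset (\<lambda>y. y \<noteq> Suc m) \<beta>)"],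
       goal_cases)
  case 1
  have "count \<beta> (Suc m) = 0" if "set_mset \<beta> \<subseteq> {1..m}" for \<beta>
    using that by (intro count_eq_zero_iff[THEN iffD2]) auto
  moreover have "filter_mset (\<lambda>y. y \<noteq> Suc m) \<beta> = \<beta>" if "set_mset \<beta> \<subseteq> {1..m}" for \<beta>
    using that by (intro filter_mset_eq_conv[THEN iffD2]) auto
  moreover have "filter_mset (\<lambda>y. y \<noteq> Suc m) (replicate_mset x (Suc m)) = {#}" for x
    by auto
  ultimately show ?case by auto
next
  case 2
  show ?case by (auto intro!: multiset_eqI)
next
  case 3
  show ?case by (auto split: if_splits)
next
  case 4
  show ?case by (fastforce simp: le_Suc_eq)
qed

text \<open>
  The diagram of a multiset with \<open>Suc m\<close> parts and least part \<open>x\<close> has \<open>x\<close> full columns; under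
  conjugation these become \<open>x\<close> parts equal to \<open>Suc m\<close>. So both sides satisfy the same recursion.
\<close>

lemma conjugation:
  "\<exists>f. bij_betw f {\<sigma> :: nat multiset. size \<sigma> = m} {\<beta>. set_mset \<beta> \<subseteq> {1..m}} \<and>
       (\<forall>\<sigma>. size \<sigma> = m \<longrightarrow> \<Sum>\<^sub># (f \<sigma>) = \<Sum>\<^sub># \<sigma>)"
proof (induction m)
  case 0
  show ?case by (rule exI[of _ id]) auto
next
  case (Suc m)
  then obtain f where
    f: "bij_betw f {\<sigma> :: nat multiset. size \<sigma> = m} {\<beta>. set_mset \<beta> \<subseteq> {1..m}}"
    and sum_f: "\<And>\<sigma>. size \<sigma> = m \<Longrightarrow> \<Sum>\<^sub># (f \<sigma>) = \<Sum>\<^sub># \<sigma>"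
    by blast
  let ?A = "UNIV \<times> {\<sigma> :: nat multiset. size \<sigma> = m} :: (nat \<times> nat multiset) set"
  let ?g = "\<lambda>(x, \<tau>). add_mset x (image_mset ((+) x) \<tau>) :: nat multiset"
  let ?h = "\<lambda>(x, \<beta>). replicate_mset x (Suc m) + \<beta>"
  let ?F = "?h \<circ> map_prod id f \<circ> inv_into ?A ?g"
  have bij: "bij_betw ?F {\<sigma>. size \<sigma> = Suc m} {\<beta>. set_mset \<beta> \<subseteq> {1..Suc m}}"
    by (intro bij_betw_trans[OF bij_betw_inv_into[OF bij_betw_split_Min]]
        bij_betw_trans[OF bij_betw_map_prod[OF bij_betw_id f] bij_betw_split_top_part])
  moreover have "\<Sum>\<^sub># (?F \<sigma>) = \<Sum>\<^sub># \<sigma>" if "size \<sigma> = Suc m" for \<sigma>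
  proof -
    have "\<sigma> \<in> ?g ` ?A" using that bij_betw_split_Min[of m] by (auto simp: bij_betw_def)
    then obtain a where a: "a \<in> ?A" "\<sigma> = ?g a" by blast
    obtain x \<tau> where x\<tau>: "a = (x, \<tau>)" by (cases a)
    have "inv_into ?A ?g \<sigma> = a"
      unfolding a(2) using a(1) by (rule bij_betw_inv_into_left[OF bij_betw_split_Min])
    then have "\<Sum>\<^sub># (?F \<sigma>) = x * Suc m + \<Sum>\<^sub># \<tau>" using a(1) by (simp add: sum_f x\<tau>)
    also have "\<dots> = \<Sum>\<^sub># \<sigma>" using a by (simp add: sum_mset.distrib x\<tau>)
    finally show ?thesis .
  qed
  ultimately show ?case by blast
qed

section \<open>Points on the boundary path\<close>

text \<open>
  The points \<open>(k, m)\<close> with positive coordinates on the lower right boundary of the Young diagram of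
  \<open>p\<close> (\<open>k\<close> counts rows and \<open>m\<close> counts columns). In terms of the parts \<open>p\<^sub>1 \<ge> p\<^sub>2 \<ge> \<dots>\<close>, padded with
  zeros, the condition is \<open>p\<^sub>k \<ge> m \<ge> p\<^bsub>k+1\<^esub>\<close>; it is expressed by counting the parts that are
  greater than \<open>m\<close> and those that are at least \<open>m\<close>.
\<close>

definition boundary_points :: "nat multiset \<Rightarrow> (nat \<times> nat) set" where
  "boundary_points p = {(k, m). 1 \<le> k \<and> 1 \<le> m \<and>
     size (filter_mset (\<lambda>x. m < x) p) \<le> k \<and> k \<le> size (filter_mset (\<lambda>x. m \<le> x) p)}"

lemma sum_antitone_telescope:
  fixes K :: "nat \<Rightarrow> nat"
  assumes "\<And>m. K (Suc m) \<le> K m"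
  shows "(\<Sum>m = 1..L. Suc (K m - K (Suc m))) + K (Suc L) = K 1 + L"
proof (induction L)
  case (Suc L)
  then show ?case using assms[of "Suc L"] by simp
qed simp

text \<open>
  Column \<open>m\<close> carries the points with \<open>K (m + 1) \<le> k \<le> K m\<close>, where \<open>K m\<close> is the number of parts
  that are at least \<open>m\<close>. In the last column the value \<open>k = 0\<close> is excluded.
\<close>

lemma card_boundary_points:
  assumes "0 \<notin># p"
  shows "finite (boundary_points p)" "card (boundary_points p) = perimeter p"
proof -
  define K where "K m = size (filter_mset (\<lambda>x. m \<le> x) p)" for m
  define L where "L = Max (insert 0 (set_mset p))"
  define c where "c m = {max 1 (K (Suc m))..K m}" for m
  have anti: "K (Suc m) \<le> K m" for m
    unfolding K_def by (intro size_mset_mono filter_mset_mono_strong) auto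
  have le_L: "x \<le> L" if "x \<in># p" for x using that by (simp add: L_def)
  have K0: "K m = 0" if "L < m" for m
    using le_L that by (force simp: K_def)
  have eq: "boundary_points p = (\<lambda>(m, k). (k, m)) ` Sigma {1..L} c"
  proof -
    have "(k, m) \<in> boundary_points p \<longleftrightarrow> m \<in> {1..L} \<and> k \<in> c m" for k m
    proof -
      have "(k, m) \<in> boundary_points p \<longleftrightarrow> 1 \<le> m \<and> k \<in> c m"
        by (auto simp: boundary_points_def c_def K_def Suc_le_eq)
      moreover have "m \<le> L" if "k \<in> c m"
        using that K0[of m] by (cases "L < m") (auto simp: c_def)
      ultimately show ?thesis by auto
    qed
    then show ?thesis by (auto simp: image_iff)
  qed
  have fin: "finite (Sigma {1..L} c)" by (auto simp: c_def)
  then show "finite (boundary_points p)" by (simp add: eq)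
  have "card (boundary_points p) = card (Sigma {1..L} c)"
    unfolding eq by (rule card_image) (auto simp: inj_on_def)
  also have "\<dots> = (\<Sum>m = 1..L. card (c m))" by (subst card_SigmaI) (auto simp: c_def)
  also have "\<dots> = perimeter p"
  proof (cases "p = {#}")
    case True
    then show ?thesis by (simp add: L_def perimeter_def)
  next
    case False
    have L: "L = Max (set_mset p)" using False by (simp add: L_def)
    have "L \<in># p" using False by (simp add: L)
    then have "L \<noteq> 0" using assms by metis
    then obtain l where l: "L = Suc l" by (cases L) auto
    have pos: "1 \<le> K m" if "m \<le> L" for m
      using \<open>L \<in># p\<close> that by (auto simp: K_def Suc_le_eq nonempty_has_size[symmetric] filter_mset_eq_mempty_iff)
    have "card (c m) = Suc (K m - K (Suc m))" if "m \<in> {1..l}" for m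
      using pos[of "Suc m"] that l anti[of m] by (auto simp: c_def max_def Suc_diff_le)
    moreover have "card (c L) = K L" using K0[of "Suc L"] by (simp add: c_def)
    ultimately have "(\<Sum>m = 1..L. card (c m)) = (\<Sum>m = 1..l. Suc (K m - K (Suc m))) + K (Suc l)"
      by (simp add: l)
    also have "\<dots> = K 1 + l" by (rule sum_antitone_telescope) (rule anti)
    also have "K 1 = size p"
    proof -
      have "filter_mset (\<lambda>x. 1 \<le> x) p = p"
        using assms by (intro filter_mset_eq_conv[THEN iffD2]) (auto simp: Suc_le_eq intro: gr0I)
      then show ?thesis by (simp add: K_def)
    qed
    finally show ?thesis using False l by (simp add: perimeter_def L)
  qed
  finally show "card (boundary_points p) = perimeter p" .
qed

section \<open>Splitting a partition at a boundary point\<close>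

text \<open>
  The \<open>k\<close> largest parts of \<open>p\<close>, if \<open>m\<close> lies between the \<open>k\<close>-th and the next part: the parts
  greater than \<open>m\<close>, filled up to \<open>k\<close> parts with copies of \<open>m\<close>.
\<close>

definition top_parts :: "nat \<Rightarrow> nat \<Rightarrow> nat multiset \<Rightarrow> nat multiset" where
  "top_parts k m p = filter_mset (\<lambda>x. m < x) p
     + replicate_mset (k - size (filter_mset (\<lambda>x. m < x) p)) m"

lemma mset_eq_filter_replicate:
  assumes "\<And>x :: nat. x \<in># T \<Longrightarrow> m \<le> x"
  shows "T = filter_mset (\<lambda>x. m < x) T + replicate_mset (count T m) m"
proof (rule multiset_eqI)
  fix x
  have "x < m \<Longrightarrow> count T x = 0" using assms[of x] by (auto simp: count_eq_zero_iff)
  then show "count T x = count (filter_mset (\<lambda>x. m < x) T + replicate_mset (count T m) m) x"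
    by (cases x m rule: linorder_cases) auto
qed

text \<open>
  So \<open>T\<close>, and hence \<open>\<beta>\<close>, can be recovered from \<open>T + \<beta>\<close> and \<open>(size T, m)\<close>; this is the injectivity
  of the correspondence below.
\<close>

lemma top_parts_unique:
  assumes "\<And>x. x \<in># T \<Longrightarrow> m \<le> x" and "\<And>x. x \<in># \<beta> \<Longrightarrow> x \<le> m"
  shows "top_parts (size T) m (T + \<beta>) = T"
proof -
  have T: "T = filter_mset (\<lambda>x. m < x) T + replicate_mset (count T m) m"
    by (rule mset_eq_filter_replicate) (rule assms(1))
  have "filter_mset (\<lambda>x. m < x) \<beta> = {#}"
    using assms(2) by (force simp: filter_mset_eq_mempty_iff)
  moreover have "size T = size (filter_mset (\<lambda>x. m < x) T) + count T m"
    using T by (metis size_union size_replicate_mset)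
  ultimately show ?thesis
    using T[symmetric] by (simp add: top_parts_def del: filter_mset_eq_mempty_iff)
qed

text \<open>The copies of \<open>m\<close> in \<open>p\<close> are shared between \<open>T\<close> and \<open>\<beta>\<close>, so as to give \<open>T\<close> exactly \<open>k\<close> parts.\<close>

lemma boundary_point_decomp:
  assumes "(k, m) \<in> boundary_points p"
  obtains T \<beta> where "p = T + \<beta>" "size T = k" "\<And>x. x \<in># T \<Longrightarrow> m \<le> x" "\<And>x. x \<in># \<beta> \<Longrightarrow> x \<le> m"
proof -
  let ?G = "filter_mset (\<lambda>x. m < x) p" and ?S = "filter_mset (\<lambda>x. x < m) p"
  define r where "r = k - size ?G"
  have p: "p = ?G + (replicate_mset (count p m) m + ?S)"
  proof (rule multiset_eqI)
    fix x
    show "count p x = count (?G + (replicate_mset (count p m) m + ?S)) x"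
      by (cases x m rule: linorder_cases) auto
  qed
  have "filter_mset (\<lambda>x. m \<le> x) p = ?G + replicate_mset (count p m) m"
    by (rule multiset_eqI) (auto simp: le_less)
  then have k: "size ?G \<le> k" "k \<le> size ?G + count p m"
    using assms by (auto simp: boundary_points_def)
  then have "r \<le> count p m" by (simp add: r_def)
  then have "replicate_mset (count p m) m = replicate_mset r m + replicate_mset (count p m - r) m"
    by (intro multiset_eqI) simp
  then have "p = (?G + replicate_mset r m) + (replicate_mset (count p m - r) m + ?S)"
    using p by (simp add: ac_simps)
  moreover have "size (?G + replicate_mset r m) = k" using k by (simp add: r_def)
  ultimately show thesis by (rule that) (auto split: if_splits)
qed

lemma boundary_points_plusI:
  assumes "\<And>x. x \<in># T \<Longrightarrow> m \<le> x" "\<And>x. x \<in># \<beta> \<Longrightarrow> x \<le> m" "T \<noteq> {#}" "1 \<le> m"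
  shows "(size T, m) \<in> boundary_points (T + \<beta>)"
proof -
  have "filter_mset (\<lambda>x. m < x) \<beta> = {#}"
    using assms(2) by (force simp: filter_mset_eq_mempty_iff)
  moreover have "filter_mset (\<lambda>x. m \<le> x) T = T"
    using assms(1) by (intro filter_mset_eq_conv[THEN iffD2]) auto
  moreover have "size (filter_mset (\<lambda>x. m < x) T) \<le> size T"
    by (rule size_filter_mset_lesseq)
  ultimately show ?thesis
    using assms(3,4) by (simp add: boundary_points_def Suc_le_eq nonempty_has_size del: filter_mset_eq_mempty_iff)
qed

section \<open>Copartitions as partitions with a boundary point\<close>

lemma bij_betw_copartitions:
  "\<exists>\<Phi>. bij_betw \<Phi> {c. is_copartition001 c \<and> copartition_size c = n}
     (Sigma (partitions_of n) boundary_points)"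
proof -
  obtain f where
    f: "\<And>m. bij_betw (f m) {\<sigma> :: nat multiset. size \<sigma> = m} {\<beta>. set_mset \<beta> \<subseteq> {1..m}}"
    and sum_f: "\<And>m \<sigma>. size \<sigma> = m \<Longrightarrow> \<Sum>\<^sub># (f m \<sigma>) = \<Sum>\<^sub># \<sigma>"
    using conjugation by metis
  have f_set: "x \<in># f (size \<sigma>) \<sigma> \<Longrightarrow> 1 \<le> x \<and> x \<le> size \<sigma>" for x \<sigma>
    using bij_betwE[OF f[of "size \<sigma>"]] by force
  \<comment> \<open>Right of the rectangle, the rows of \<open>\<gamma>\<close> are lengthened by \<open>size \<sigma>\<close>; below it, \<open>f\<close>
    contributes the rows of the transpose of \<open>\<sigma>\<close>.\<close>
  define \<Phi> :: "nat multiset \<times> nat multiset \<times> nat multiset \<Rightarrow> nat multiset \<times> nat \<times> nat"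
    where "\<Phi> = (\<lambda>(\<gamma>, \<rho>, \<sigma>).
      (image_mset ((+) (size \<sigma>)) \<gamma> + f (size \<sigma>) \<sigma>, (size \<gamma>, size \<sigma>)))"
  let ?C = "{c. is_copartition001 c \<and> copartition_size c = n}"
  have inj: "inj_on \<Phi> ?C"
  proof (rule inj_onI)
    fix c c' assume c: "c \<in> ?C" "c' \<in> ?C" and eq: "\<Phi> c = \<Phi> c'"
    obtain \<gamma> \<rho> \<sigma> \<gamma>' \<rho>' \<sigma>' where [simp]: "c = (\<gamma>, \<rho>, \<sigma>)" "c' = (\<gamma>', \<rho>', \<sigma>')"
      by (cases c, cases c') blast
    define m where "m = size \<sigma>"
    have s: "size \<gamma>' = size \<gamma>" "size \<sigma> = m" "size \<sigma>' = m" using eq by (auto simp: \<Phi>_def m_def)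
    let ?T = "image_mset ((+) m) \<gamma>" and ?T' = "image_mset ((+) m) \<gamma>'"
    have sum: "?T + f m \<sigma> = ?T' + f m \<sigma>'" using eq s by (simp add: \<Phi>_def)
    have "top_parts (size ?T) m (?T + f m \<sigma>) = ?T"
      using f_set[of _ \<sigma>] s by (intro top_parts_unique) auto
    moreover have "top_parts (size ?T') m (?T' + f m \<sigma>') = ?T'"
      using f_set[of _ \<sigma>'] s by (intro top_parts_unique) auto
    ultimately have T: "?T = ?T'" using sum s by simp
    then have "\<gamma> = \<gamma>'" using multiset.inj_map[of "(+) m"] by (auto simp: inj_def)
    moreover have "\<sigma> = \<sigma>'"
      using sum T s bij_betw_imp_inj_on[OF f[of m]] by (auto dest: inj_onD)
    ultimately show "c = c'" using c by (auto simp: is_copartition001_def)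
  qed
  have sub: "\<Phi> ` ?C \<subseteq> Sigma (partitions_of n) boundary_points"
  proof
    fix y assume "y \<in> \<Phi> ` ?C"
    then obtain \<gamma> \<rho> \<sigma> where c: "(\<gamma>, \<rho>, \<sigma>) \<in> ?C" and y: "y = \<Phi> (\<gamma>, \<rho>, \<sigma>)" by auto
    have ne: "\<gamma> \<noteq> {#}" "\<sigma> \<noteq> {#}" and n: "\<Sum>\<^sub># \<gamma> + size \<sigma> * size \<gamma> + \<Sum>\<^sub># \<sigma> = n"
      using c by (auto simp: is_copartition001_def copartition_size_def)
    let ?T = "image_mset ((+) (size \<sigma>)) \<gamma>"
    have "1 \<le> size \<sigma>" using ne by (simp add: Suc_le_eq nonempty_has_size)
    then have "(size ?T, size \<sigma>) \<in> boundary_points (?T + f (size \<sigma>) \<sigma>)"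
      using ne f_set[of _ \<sigma>] by (intro boundary_points_plusI) auto
    moreover have "?T + f (size \<sigma>) \<sigma> \<in> partitions_of n"
      using n ne f_set[of 0 \<sigma>] by (auto simp: partitions_of_def sum_mset.distrib sum_f mult.commute)
    ultimately show "y \<in> Sigma (partitions_of n) boundary_points" by (simp add: y \<Phi>_def)
  qed
  have sur: "Sigma (partitions_of n) boundary_points \<subseteq> \<Phi> ` ?C"
  proof clarify
    fix p k m assume p: "p \<in> partitions_of n" and km: "(k, m) \<in> boundary_points p"
    from km obtain T \<beta> where d: "p = T + \<beta>" "size T = k" "\<And>x. x \<in># T \<Longrightarrow> m \<le> x" "\<And>x. x \<in># \<beta> \<Longrightarrow> x \<le> m"
      by (rule boundary_point_decomp) blast
    have pos: "1 \<le> k" "1 \<le> m" using km by (auto simp: boundary_points_def)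
    have "set_mset \<beta> \<subseteq> {1..m}"
      using p d by (auto simp: partitions_of_def Suc_le_eq intro!: gr0I)
    then have "\<beta> \<in> f m ` {\<sigma>. size \<sigma> = m}"
      unfolding bij_betw_imp_surj_on[OF f[of m]] by simp
    then obtain \<sigma> where \<sigma>: "size \<sigma> = m" "f m \<sigma> = \<beta>" by blast
    define \<gamma> where "\<gamma> = image_mset (\<lambda>x. x - m) T"
    have size_\<gamma>: "size \<gamma> = k" using d(2) by (simp add: \<gamma>_def)
    have "image_mset ((+) m) \<gamma> = image_mset (\<lambda>x. x) T"
      unfolding \<gamma>_def multiset.map_comp comp_def by (rule image_mset_cong) (use d(3) in auto)
    then have T: "image_mset ((+) m) \<gamma> = T" by simp
    have "\<Sum>\<^sub># T = k * m + \<Sum>\<^sub># \<gamma>"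
      unfolding T[symmetric] using size_\<gamma> by (simp add: sum_mset.distrib)
    moreover have "\<Sum>\<^sub># \<beta> = \<Sum>\<^sub># \<sigma>" using sum_f[of \<sigma> m] \<sigma> by simp
    ultimately have "\<Sum>\<^sub># \<gamma> + m * k + \<Sum>\<^sub># \<sigma> = n"
      using p d(1) by (simp add: partitions_of_def mult.commute)
    moreover have "\<gamma> \<noteq> {#}" "\<sigma> \<noteq> {#}" using pos size_\<gamma> \<sigma> by auto
    ultimately have "(\<gamma>, replicate_mset m k, \<sigma>) \<in> ?C"
      using \<sigma> size_\<gamma> by (auto simp: is_copartition001_def copartition_size_def)
    moreover have "\<Phi> (\<gamma>, replicate_mset m k, \<sigma>) = (p, k, m)"
      using \<sigma> T d size_\<gamma> by (simp add: \<Phi>_def)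
    ultimately show "(p, k, m) \<in> \<Phi> ` ?C" by (metis imageI)
  qed
  show ?thesis using inj sub sur by (intro exI[of _ \<Phi>]) (simp add: bij_betw_def subset_antisym)
qed

theorem theorem4p14:
  fixes n :: nat
  shows "cp001 n = (\<Sum>p\<in>partitions_of n. perimeter p)"
proof -
  have "cp001 n = card (Sigma (partitions_of n) boundary_points)"
    unfolding cp001_def using bij_betw_copartitions[of n] by (auto dest: bij_betw_same_card)
  also have "\<dots> = (\<Sum>p\<in>partitions_of n. card (boundary_points p))"
    using finite_partitions_of[of n] card_boundary_points(1)
    by (intro card_SigmaI) (auto simp: partitions_of_def)
  also have "\<dots> = (\<Sum>p\<in>partitions_of n. perimeter p)"
    by (rule sum.cong) (auto simp: partitions_of_def card_boundary_points(2))
  finally show ?thesis .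
qed

end
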